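(* Let $v$ be a packed word of length $n$. Then $$U_v(t):=(\sigma_1^t)_n*\mathbf{N}_v=\sum_{k=1}^n t^k\,E_n^{[k]}*\mathbf{N}_v=\sum_{w\in \mathrm{WRef}(v)}\binom{t+\max(w)-a_0(v,w)}{\max(w)}\,\mathbf{N}_w,$$ where $a_0(v,w)=\max(u_0(v,w))$.
   Context: $\mathbb{K}$ is a field of characteristic $0$, $t$ an indeterminate, and $\binom{t+c}{m}=\frac{(t+c)(t+c-1)\cdots(t+c-m+1)}{m!}$. A word over the positive integers is packed if its set of letters is $\{1,\dots,r\}$ for some $r$; then $r=\max(u)$. For a word $w$ over a totally ordered alphabet with distinct letters $b_1<\dots<b_r$, $\mathrm{pack}(w)$ is obtained by replacing each $b_i$ by $i$. A packed word $u=u_1\cdots u_n$ is identified with the set composition of $\{1,\dots,n\}$ whose $i$-th block is $\{j:u_j=i\}$. For packed words $v,w$ of length $n$, $w$ is a weak refinement of $v$, written $w\in\mathrm{WRef}(v)$, if $w_i=w_j\Rightarrow v_i=v_j$ for all $i,j$ (each block of $v$ is a union of blocks of $w$). For $w\in\mathrm{WRef}(v)$, $u_0(v,w)$ is the set composition obtained from $w$ by merging two consecutive blocks $p',p''$ whenever the blocks of $v$ containing (the elements of) $p'$ are strictly to the left of those containing (the elements of) $p''$ (i.e. $v_i<v_j$ for all $i\in p'$, $j\in p''$), and iterating until no further blocks can be merged. $\mathbf{WQSym}^*_n$ is the $\mathbb{K}$-vector space with basis $\mathbf{N}_u$, $u$ running over packed words of length $n$, with internal product $\mathbf{N}_u*\mathbf{N}_v=\mathbf{N}_{\mathrm{pack}\binom{u}{v}}$,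 where $\binom{u}{v}$ is the word of biletters $\binom{u_1}{v_1}\cdots\binom{u_n}{v_n}$, ordered lexicographically with priority to the top letter; scalars are extended to $\mathbb{K}[t]$. The degree $n$ component of $\sigma_1^t$ is $$(\sigma_1^t)_n=\sum_{|u|=n}\binom{t}{\max(u)}\mathbf{N}_u=\sum_{k=1}^n t^kE_n^{[k]},$$ the first sum being over all packed words of length $n$; the second equality defines the Eulerian idempotents $E_n^{[k]}$. *)

theory Defs
  imports
    "HOL-Computational_Algebra.Polynomial"
    "HOL-Library.Poly_Mapping"
    "HOL-Library.Product_Lexorder"
begin

section \<open>Packed words\<close>

definition packed :: "nat list \<Rightarrow> bool" where
  "packed u \<longleftrightarrow> (\<exists>r. set u = {1..r})"

definition packed_words :: "nat \<Rightarrow> nat list set" where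
  "packed_words n = {u. length u = n \<and> packed u}"

text \<open>The largest letter of a word; the empty word gets \<open>0\<close>.\<close>

definition maxw :: "nat list \<Rightarrow> nat" where
  "maxw u = Max (insert 0 (set u))"

definition pack :: "'a::linorder list \<Rightarrow> nat list" where
  "pack w = map (\<lambda>b. card {c \<in> set w. c \<le> b}) w"

definition WRef :: "nat list \<Rightarrow> nat list set" where
  "WRef v = {w \<in> packed_words (length v).
     \<forall>i<length v. \<forall>j<length v. w ! i = w ! j \<longrightarrow> v ! i = v ! j}"

section \<open>Merging blocks\<close>

text \<open>The \<open>k\<close>-th block (\<open>1 \<le> k \<le> maxw u\<close>) of the set composition encoded by \<open>u\<close>;
  positions are counted from \<open>0\<close>.\<close>

definition block :: "nat list \<Rightarrow> nat \<Rightarrow> nat set" where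
  "block u k = {j. j < length u \<and> u ! j = k}"

definition merge :: "nat \<Rightarrow> nat list \<Rightarrow> nat list" where
  "merge k u = map (\<lambda>x. if x \<le> k then x else x - 1) u"

definition merge_step :: "nat list \<Rightarrow> nat list \<Rightarrow> nat list \<Rightarrow> bool" where
  "merge_step v p q \<longleftrightarrow> (\<exists>k. 1 \<le> k \<and> k < maxw p \<and>
     (\<forall>i \<in> block p k. \<forall>j \<in> block p (Suc k). v ! i < v ! j) \<and> q = merge k p)"

text \<open>For \<open>w \<in> WRef v\<close> the final result does not depend on the order of the merges: the
  merges allowed initially are independent of each other and no new ones ever appear.\<close>

definition u0 :: "nat list \<Rightarrow> nat list \<Rightarrow> nat list" where
  "u0 v w = (THE u. (merge_step v)\<^sup>*\<^sup>* w u \<and> (\<nexists>u'. merge_step v u u'))"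

definition a0 :: "nat list \<Rightarrow> nat list \<Rightarrow> nat" where
  "a0 v w = maxw (u0 v w)"

section \<open>The internal product\<close>

text \<open>Elements are finitely supported coefficient functions on words, with coefficients in
  \<open>\<bbbK>\<close> or in \<open>\<bbbK>[t]\<close>. The order on biletters is the lexicographic one
  of \<^theory>\<open>HOL-Library.Product_Lexorder\<close>.\<close>

definition N :: "nat list \<Rightarrow> (nat list \<Rightarrow>\<^sub>0 'b::comm_ring_1)" where
  "N u = Poly_Mapping.single u 1"

definition scale :: "'b::comm_ring_1 \<Rightarrow> (nat list \<Rightarrow>\<^sub>0 'b) \<Rightarrow> (nat list \<Rightarrow>\<^sub>0 'b)" where
  "scale c x = Poly_Mapping.map ((*) c) x"

text \<open>The bilinear product on each homogeneous component; components of different degrees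
  multiply to \<open>0\<close>.\<close>

definition iprod ::
  "(nat list \<Rightarrow>\<^sub>0 'b::comm_ring_1) \<Rightarrow> (nat list \<Rightarrow>\<^sub>0 'b) \<Rightarrow> (nat list \<Rightarrow>\<^sub>0 'b)"
  (infixl \<open>\<^bold>*\<close> 70) where
  "x \<^bold>* y = (\<Sum>u \<in> Poly_Mapping.keys x. \<Sum>v \<in> Poly_Mapping.keys y.
     if length u = length v
     then scale (Poly_Mapping.lookup x u * Poly_Mapping.lookup y v) (N (pack (zip u v))) else 0)"

definition extend :: "(nat list \<Rightarrow>\<^sub>0 'a::comm_ring_1) \<Rightarrow> (nat list \<Rightarrow>\<^sub>0 'a poly)" where
  "extend x = Poly_Mapping.map (\<lambda>c. [:c:]) x"

section \<open>Eulerian idempotents\<close>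

abbreviation tvar :: "'a::comm_ring_1 poly" where
  "tvar \<equiv> [:0, 1:]"

text \<open>\<^const>\<open>gbinomial\<close> is only available over fields, hence not in \<open>\<bbbK>[t]\<close>;
  \<open>poly_binom\<close> below relates the two.\<close>

definition binom :: "'a::field_char_0 poly \<Rightarrow> nat \<Rightarrow> 'a poly" where
  "binom p m = smult (1 / fact m) (\<Prod>i<m. p - of_nat i)"

lemma poly_binom: "poly (binom p m) x = poly p x gchoose m"
  by (simp add: binom_def gbinomial_prod_rev poly_prod atLeast0LessThan)

definition sigma :: "nat \<Rightarrow> (nat list \<Rightarrow>\<^sub>0 'a::field_char_0 poly)" where
  "sigma n = (\<Sum>u \<in> packed_words n. scale (binom tvar (maxw u)) (N u))"

text \<open>\<open>E n k\<close> is the coefficient of \<open>t\<^sup>k\<close> in \<open>sigma n\<close>; see \<open>sigma_eq_sum_E\<close> below.\<close>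

definition E :: "nat \<Rightarrow> nat \<Rightarrow> (nat list \<Rightarrow>\<^sub>0 'a::field_char_0)" where
  "E n k = Poly_Mapping.map (\<lambda>p. coeff p k) (sigma n)"

lemma lookup_scale [simp]:
  "Poly_Mapping.lookup (scale c x) u = c * Poly_Mapping.lookup x u"
  by (auto simp: scale_def Poly_Mapping.map.rep_eq when_def)

lemma lookup_extend [simp]:
  "Poly_Mapping.lookup (extend x) u = [:Poly_Mapping.lookup x u:]"
  by (auto simp: extend_def Poly_Mapping.map.rep_eq when_def)

lemma lookup_E [simp]:
  "Poly_Mapping.lookup (E n k) u = coeff (Poly_Mapping.lookup (sigma n) u) k"
  by (auto simp: E_def Poly_Mapping.map.rep_eq when_def)

lemma maxw_packed: "set u = {1..r} \<Longrightarrow> maxw u = r"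
  unfolding maxw_def by (intro Max_eqI) auto

lemma maxw_le_length:
  assumes "packed u"
  shows "maxw u \<le> length u"
proof -
  obtain r where r: "set u = {1..r}"
    using assms by (auto simp: packed_def)
  then have "maxw u = card (set u)"
    by (simp add: maxw_packed)
  then show ?thesis
    using card_length by metis
qed

lemma finite_packed_words [simp]: "finite (packed_words n)"
proof (rule finite_subset)
  show "packed_words n \<subseteq> {u. set u \<subseteq> {..n} \<and> length u = n}"
  proof
    fix u assume "u \<in> packed_words n"
    then have u: "length u = n" "packed u"
      by (auto simp: packed_words_def)
    then obtain r where r: "set u = {1..r}"
      by (auto simp: packed_def)
    have "r \<le> n"
      using maxw_le_length[OF u(2)] maxw_packed[OF r] u(1) by simp
    with r u(1) show "u \<in> {u. set u \<subseteq> {..n} \<and> length u = n}"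
      by auto
  qed
qed (rule finite_lists_length_eq, simp)

lemma lookup_sigma:
  "Poly_Mapping.lookup (sigma n) u = (if u \<in> packed_words n then binom tvar (maxw u) else 0)"
  by (simp add: sigma_def Poly_Mapping.lookup_sum N_def lookup_single when_def if_distrib
      cong: if_cong)

lemma sigma_eq_sum_E:
  assumes "n \<ge> 1"
  shows "(sigma n :: nat list \<Rightarrow>\<^sub>0 'a::field_char_0 poly)
    = (\<Sum>k=1..n. scale (monom 1 k) (extend (E n k)))"
proof (rule poly_mapping_eqI)
  fix u
  let ?p = "Poly_Mapping.lookup (sigma n :: nat list \<Rightarrow>\<^sub>0 'a poly) u"
  have *: "coeff ?p 0 = 0 \<and> degree ?p \<le> n"
  proof (cases "u \<in> packed_words n")
    case True
    then have l: "length u = n" and pu: "packed u"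
      by (auto simp: packed_words_def)
    then have "set u \<noteq> {}"
      using assms by auto
    then have pos: "maxw u > 0"
      using pu maxw_packed by (fastforce simp: packed_def)
    have p: "?p = smult (1 / fact (maxw u)) (\<Prod>i<maxw u. tvar - of_nat i)"
      using True by (simp add: lookup_sigma binom_def)
    have "coeff (\<Prod>i<maxw u. (tvar :: 'a poly) - of_nat i) 0 = 0"
      using pos unfolding poly_0_coeff_0[symmetric] poly_prod
      by (intro prod_zero) (auto intro!: bexI[of _ 0])
    moreover have "degree (\<Prod>i<maxw u. (tvar :: 'a poly) - of_nat i) \<le> (\<Sum>i<maxw u. 1)"
      by (rule order_trans[OF degree_prod_sum_le sum_mono])
         (auto simp: of_nat_poly)
    ultimately show ?thesis
      using maxw_le_length[OF pu] l p by simp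
  qed (simp add: lookup_sigma)
  have "?p = (\<Sum>k\<le>n. monom (coeff ?p k) k)"
    using * by (simp add: poly_as_sum_of_monoms')
  also have "\<dots> = (\<Sum>k=1..n. monom (coeff ?p k) k)"
    using * by (intro sum.mono_neutral_right) (auto simp: not_le)
  also have "\<dots> = Poly_Mapping.lookup (\<Sum>k=1..n. scale (monom 1 k) (extend (E n k))) u"
    by (simp add: Poly_Mapping.lookup_sum smult_monom)
  finally show "?p = Poly_Mapping.lookup (\<Sum>k=1..n. scale (monom 1 k) (extend (E n k))) u" .
qed

end

theory Submission
  imports Defs
begin

text \<open>Write \<open>v = map g w\<close> for \<open>w \<in> WRef v\<close> with \<open>r = maxw w\<close>. The coarsenings of \<open>w\<close> that only merge
  consecutive blocks are the words \<open>map (cut S) w\<close>, where \<open>S \<subseteq> {1..<r}\<close> is the set of walls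
  that are kept. Let \<open>D\<close> be the set of weak descents of \<open>g\<close>. The packed words \<open>u\<close> with
  \<open>pack (zip u v) = w\<close> are exactly the coarsenings with \<open>D \<subseteq> S\<close>, and a merging step removes one
  element of \<open>S - D\<close> from \<open>S\<close>, so that \<open>u0 v w\<close> is the coarsening with \<open>S = D\<close>. The coefficient
  of \<open>N w\<close> is therefore the sum of \<open>binom t (1 + card S)\<close> over all \<open>S\<close> between \<open>D\<close> and
  \<open>{1..<r}\<close>, which Pascal's rule evaluates.\<close>

section \<open>Packing as ranking, and factorizations of words through it\<close>

section \<open>Packing\<close>

lemma rank_less_iff:
  fixes x y :: "'a::linorder"
  assumes "finite A" "x \<in> A" "y \<in> A"
  shows "card {c \<in> A. c \<le> x} < card {c \<in> A. c \<le> y} \<longleftrightarrow> x < y"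
proof -
  have *: "card {c \<in> A. c \<le> x} < card {c \<in> A. c \<le> y}" if "x < y" "y \<in> A" for x y
  proof (rule psubset_card_mono)
    have "y \<in> {c \<in> A. c \<le> y}" "y \<notin> {c \<in> A. c \<le> x}"
      using that by auto
    then show "{c \<in> A. c \<le> x} \<subset> {c \<in> A. c \<le> y}"
      using that(1) by fastforce
  qed (use assms(1) in simp)
  show ?thesis
    using *[of x y] *[of y x] assms by (cases x y rule: linorder_cases) auto
qed

lemma inj_on_rank:
  fixes A :: "'a::linorder set"
  assumes "finite A"
  shows "inj_on (\<lambda>x. card {c \<in> A. c \<le> x}) A"
proof (rule inj_onI)
  fix x y assume "x \<in> A" "y \<in> A" "card {c \<in> A. c \<le> x} = card {c \<in> A. c \<le> y}"
  then show "x = y"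
    using rank_less_iff[OF assms, of x y] rank_less_iff[OF assms, of y x]
    by (cases x y rule: linorder_cases) auto
qed

lemma length_pack [simp]: "length (pack z) = length z"
  by (simp add: pack_def)

lemma set_pack: "set (pack z) = {1..card (set z)}"
proof -
  let ?f = "\<lambda>b. card {c \<in> set z. c \<le> b}"
  have "inj_on ?f (set z)"
    by (rule inj_on_rank) simp
  moreover have "?f ` set z \<subseteq> {1..card (set z)}"
    by (auto simp: Suc_le_eq card_gt_0_iff intro!: card_mono)
  ultimately have "?f ` set z = {1..card (set z)}"
    by (intro card_subset_eq) (auto simp: card_image)
  then show ?thesis
    by (simp add: pack_def)
qed

lemma pack_packed:
  assumes "set w = {1..r}"
  shows "pack w = w"
  unfolding pack_def
proof (rule map_idI)
  fix x assume "x \<in> set w"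
  then have "{c \<in> set w. c \<le> x} = {1..x}"
    using assms by auto
  then show "card {c \<in> set w. c \<le> x} = x"
    by simp
qed

lemma pack_map:
  assumes "strict_mono_on (set w) f"
  shows "pack (map f w) = pack w"
proof -
  have "card {c \<in> f ` set w. c \<le> f b} = card {c \<in> set w. c \<le> b}" if "b \<in> set w" for b
  proof -
    have "{c \<in> f ` set w. c \<le> f b} = f ` {c \<in> set w. c \<le> b}"
      using that by (auto simp: strict_mono_on_less_eq[OF assms])
    moreover have "inj_on f {c \<in> set w. c \<le> b}"
      using strict_mono_on_imp_inj_on[OF assms] by (rule inj_on_subset) auto
    ultimately show ?thesis
      by (simp add: card_image)
  qed
  then show ?thesis
    by (simp add: pack_def)
qed

text \<open>The rank function is injective on the letters, and its inverse serves as
  \<open>f\<close>. Together with \<open>pack_map\<close> and \<open>pack_packed\<close>, this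
  replaces an equation \<open>pack z = w\<close> by a strictly increasing relabelling of
  \<open>w\<close>.\<close>

lemma pack_factor:
  obtains f where "z = map f (pack z)" "strict_mono_on (set (pack z)) f"
proof
  let ?h = "\<lambda>b. card {c \<in> set z. c \<le> b}"
  let ?f = "inv_into (set z) ?h"
  have inj: "inj_on ?h (set z)"
    by (rule inj_on_rank) simp
  show "z = map ?f (pack z)"
    unfolding pack_def map_map by (rule map_idI[symmetric]) (simp add: inv_into_f_f[OF inj])
  show "strict_mono_on (set (pack z)) ?f"
    by (rule strict_mono_onI) (auto simp: pack_def inv_into_f_f[OF inj] rank_less_iff)
qed

text \<open>Equal letters of the packed word come from equal biletters, hence from equal bottom
  letters. So no \<open>N w\<close> with \<open>w\<close> outside \<open>WRef v\<close> can occur in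
  the product.\<close>

lemma pack_zip_in_WRef:
  assumes "length u = length v"
  shows "pack (zip u v) \<in> WRef v"
proof -
  obtain f where f: "zip u v = map f (pack (zip u v))"
    by (rule pack_factor)
  have "v ! i = snd (f (pack (zip u v) ! i))" if "i < length v" for i
    using that assms arg_cong[OF f, of "\<lambda>z. snd (z ! i)"] by simp
  then show ?thesis
    using assms set_pack[of "zip u v"] by (auto simp: WRef_def packed_words_def packed_def)
qed

text \<open>Every block of \<open>w\<close> lies in one block of \<open>v\<close>, so any position
  chosen in it determines the letter of \<open>v\<close>. From here on, functions on letters replace
  positions.\<close>

lemma WRef_factor:
  assumes "w \<in> WRef v"
  obtains g where "v = map g w"
proof
  let ?g = "\<lambda>k. v ! (SOME i. i < length v \<and> w ! i = k)"
  have l: "length w = length v"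
    and ref: "\<And>i j. i < length v \<Longrightarrow> j < length v \<Longrightarrow> w ! i = w ! j \<Longrightarrow> v ! i = v ! j"
    using assms unfolding WRef_def packed_words_def by blast+
  show "v = map ?g w"
  proof (rule nth_equalityI)
    fix i assume i: "i < length v"
    define j where "j = (SOME j. j < length v \<and> w ! j = w ! i)"
    have j: "j < length v \<and> w ! j = w ! i"
      unfolding j_def by (rule someI[of _ i]) (simp add: i)
    have "map ?g w ! i = v ! j"
      using i l by (simp add: j_def)
    also have "v ! j = v ! i"
      by (rule ref) (use i j in auto)
    finally show "v ! i = map ?g w ! i"
      by (rule sym)
  qed (simp add: l)
qed

section \<open>Coarsenings of a packed word, indexed by sets of kept walls\<close>

section \<open>Coarsenings\<close>

text \<open>A wall \<open>k\<close> separates the letters \<open>k\<close> and \<open>Suc k\<close>.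
  A letter is renumbered by the kept walls to its left, and \<open>Suc\<close> makes the numbering
  start at 1.\<close>

definition cut :: "nat set \<Rightarrow> nat \<Rightarrow> nat" where
  "cut S x = Suc (card (S \<inter> {..<x}))"

definition weak_descents :: "(nat \<Rightarrow> 'a::linorder) \<Rightarrow> nat \<Rightarrow> nat set" where
  "weak_descents g r = {k \<in> {1..<r}. g (Suc k) \<le> g k}"

lemma cut_Suc: "cut S (Suc x) = (if x \<in> S then Suc (cut S x) else cut S x)"
  by (simp add: cut_def lessThan_Suc)

lemma cut_mono: "x \<le> y \<Longrightarrow> cut S x \<le> cut S y"
  by (auto simp: cut_def intro!: card_mono)

lemma cut_1: "S \<subseteq> {1..<r} \<Longrightarrow> cut S (Suc 0) = Suc 0"
  by (auto simp: cut_def)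

lemma cut_top: "S \<subseteq> {1..<r} \<Longrightarrow> cut S r = Suc (card S)"
  by (auto simp: cut_def intro!: arg_cong[of _ _ card])

lemma cut_full: "x \<in> {1..r} \<Longrightarrow> cut {1..<r} x = x"
proof -
  assume "x \<in> {1..r}"
  then have "{1..<r} \<inter> {..<x} = {1..<x}" "1 \<le> x"
    by auto
  then show ?thesis
    by (simp add: cut_def)
qed

text \<open>Losing the wall \<open>s\<close> lowers exactly the letters to the right of
  \<open>s\<close>; this is the effect of \<open>merge\<close> on a coarsening.\<close>

lemma cut_remove:
  assumes "s \<in> S"
  shows "cut (S - {s}) x = (if x \<le> s then cut S x else cut S x - 1)"
proof (cases "x \<le> s")
  case True
  then have "(S - {s}) \<inter> {..<x} = S \<inter> {..<x}"
    by auto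
  then show ?thesis
    using True by (simp add: cut_def)
next
  case False
  then have *: "(S - {s}) \<inter> {..<x} = (S \<inter> {..<x}) - {s}" "s \<in> S \<inter> {..<x}"
    using assms by auto
  then have "card (S \<inter> {..<x}) > 0"
    by (auto simp: card_gt_0_iff)
  then show ?thesis
    using False * by (simp add: cut_def)
qed

lemma cut_wall:
  assumes S: "S \<subseteq> {1..<r}" and k: "1 \<le> k" "k < Suc (card S)"
  obtains s where "s \<in> S" "cut S s = k"
proof -
  \<comment> \<open>\<open>cut S\<close> grows by at most 1 at a time, so the predecessor of the
    first letter above level \<open>k\<close> is a wall of level \<open>k\<close>.\<close>
  let ?s = "LEAST x. k < cut S x"
  have "k < cut S r"
    using k by (simp add: cut_top[OF S])
  then have L: "k < cut S ?s" "\<And>x. x < ?s \<Longrightarrow> cut S x \<le> k"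
    by (auto intro: LeastI dest: not_less_Least)
  have "?s \<noteq> 0"
  proof
    assume "?s = 0"
    then show False
      using L(1) k by (simp add: cut_def)
  qed
  then obtain s where s: "?s = Suc s"
    using not0_implies_Suc by blast
  have "k < cut S (Suc s)" "cut S s \<le> k"
    using L(1) L(2)[of s] unfolding s by auto
  then show thesis
    by (intro that[of s]) (auto simp: cut_Suc split: if_splits)
qed

lemma cut_less_iff:
  assumes "s \<in> S"
  shows "cut S s < cut S x \<longleftrightarrow> s < x"
proof
  assume "s < x"
  then have "cut S (Suc s) \<le> cut S x"
    by (intro cut_mono) auto
  then show "cut S s < cut S x"
    using assms by (simp add: cut_Suc)
next
  show "cut S s < cut S x \<Longrightarrow> s < x"
    using cut_mono[of x s S] by (meson not_le)
qed

lemma mem_iff_cut: "k \<in> S \<longleftrightarrow> cut S k < cut S (Suc k)"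
  by (simp add: cut_Suc)

lemma set_cut:
  assumes S: "S \<subseteq> {1..<r}" and r: "1 \<le> r"
  shows "cut S ` {1..r} = {1..Suc (card S)}"
proof (intro equalityI subsetI)
  fix k assume "k \<in> cut S ` {1..r}"
  then obtain x where "k = cut S x" "x \<le> r"
    by auto
  then show "k \<in> {1..Suc (card S)}"
    using cut_mono[of x r S] cut_top[OF S] by (auto simp: cut_def)
next
  fix k assume k: "k \<in> {1..Suc (card S)}"
  show "k \<in> cut S ` {1..r}"
  proof (cases "k = Suc (card S)")
    case True
    then show ?thesis
      using cut_top[OF S] r by (intro image_eqI[of _ _ r]) auto
  next
    case False
    then obtain s where "s \<in> S" "cut S s = k"
      using cut_wall[OF S, of k] k by auto
    then show ?thesis
      using S by auto
  qed
qed

lemma set_map_cut: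
  assumes "set w = {1..r}" "1 \<le> r" "S \<subseteq> {1..<r}"
  shows "set (map (cut S) w) = {1..Suc (card S)}"
  using set_cut[OF assms(3,2)] assms(1) by simp

lemma inj_on_map_cut:
  assumes w: "set w = {1..r}"
  shows "inj_on (\<lambda>S. map (cut S) w) (Pow {1..<r})"
proof (rule inj_onI)
  fix S T assume ST: "S \<in> Pow {1..<r}" "T \<in> Pow {1..<r}" "map (cut S) w = map (cut T) w"
  then have eq: "cut S k = cut T k" if "k \<in> {1..r}" for k
    using that w by auto
  have "k \<in> S \<longleftrightarrow> k \<in> T" if "k \<in> {1..<r}" for k
    using that by (simp add: mem_iff_cut[of k] eq)
  then show "S = T"
    using ST by blast
qed

section \<open>The left factors \<open>u\<close> with \<open>pack (zip u v) = w\<close>\<close>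

lemma interval_strict_mono:
  fixes f :: "nat \<Rightarrow> 'a::linorder"
  assumes "\<And>k. x \<le> k \<Longrightarrow> k < y \<Longrightarrow> f k < f (Suc k)" "x < y"
  shows "f x < f y"
  using assms(2,1)
proof (induction y)
  case (Suc y)
  show ?case
  proof (cases "x = y")
    case False
    then have "f x < f y"
      using Suc by auto
    also have "f y < f (Suc y)"
      using Suc by auto
    finally show ?thesis .
  qed (use Suc in auto)
qed simp

text \<open>A weakly increasing map onto an initial interval starts at 1 and moves by steps of 0 or
  1, so the places where it jumps determine it.\<close>

lemma mono_surj_eq_cut:
  assumes img: "h ` {1..r} = {1..m}" and mono: "mono_on {1..r} h" and x: "x \<in> {1..r}"
  shows "h x = cut {k \<in> {1..<r}. h k < h (Suc k)} x"
proof -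
  let ?S = "{k \<in> {1..<r}. h k < h (Suc k)}"
  have "1 \<le> x" "x \<le> r"
    using x by auto
  then show ?thesis
  proof (induction x rule: dec_induct)
    case base
    have "h 1 \<in> {1..m}"
      unfolding img[symmetric] using base by auto
    then have "1 \<in> h ` {1..r}"
      unfolding img by simp
    then obtain j where j: "j \<in> {1..r}" "h j = 1"
      by auto
    then have "h 1 \<le> 1"
      using monotone_onD[OF mono, of 1 j] by auto
    with \<open>h 1 \<in> {1..m}\<close> show ?case
      using cut_1[of ?S r] by (simp add: subset_eq)
  next
    case (step x)
    have x: "x \<in> {1..r}" "Suc x \<in> {1..r}"
      using step by auto
    then have "h x \<in> {1..m}" "h (Suc x) \<in> {1..m}"
      unfolding img[symmetric] by blast+
    moreover have "h x \<le> h (Suc x)"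
      using monotone_onD[OF mono x] by auto
    moreover have "h (Suc x) \<le> Suc (h x)"
    proof (rule ccontr)
      \<comment> \<open>A larger jump would skip the value \<open>Suc (h x)\<close>; by monotonicity
        no letter on either side of the jump could attain it.\<close>
      assume gap: "\<not> h (Suc x) \<le> Suc (h x)"
      then have "Suc (h x) \<in> h ` {1..r}"
        unfolding img using \<open>h (Suc x) \<in> {1..m}\<close> by auto
      then obtain j where j: "j \<in> {1..r}" "h j = Suc (h x)"
        by auto
      show False
      proof (cases "j \<le> x")
        case True
        then show False
          using monotone_onD[OF mono j(1) x(1)] j(2) by auto
      next
        case False
        then show False
          using monotone_onD[OF mono x(2) j(1)] j(2) gap by auto
      qed
    qed
    ultimately show ?case
      using step by (auto simp: cut_Suc)
  qed
qed

text \<open>The product condition says that the biletters increase strictly along the letters of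
  \<open>w\<close>. Between neighbours this needs either a wall, which raises the top letter, or a
  strict increase of \<open>g\<close>.\<close>

lemma pack_zip_eq_iff:
  assumes w: "set w = {1..r}" and r: "1 \<le> r"
  shows "packed u \<and> length u = length w \<and> pack (zip u (map g w)) = w
    \<longleftrightarrow> (\<exists>S. weak_descents g r \<subseteq> S \<and> S \<subseteq> {1..<r} \<and> u = map (cut S) w)"
    (is "?L \<longleftrightarrow> ?R")
proof
  assume ?R
  then obtain S where S: "weak_descents g r \<subseteq> S" "S \<subseteq> {1..<r}" and u: "u = map (cut S) w"
    by blast
  let ?f = "\<lambda>k. (cut S k, g k)"
  have "strict_mono_on (set w) ?f"
  proof (rule strict_mono_onI)
    fix x y assume xy: "x \<in> set w" "y \<in> set w" "x < y"
    show "?f x < ?f y"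
    proof (rule interval_strict_mono[OF _ xy(3)])
      fix k assume "x \<le> k" "k < y"
      then have "k \<in> {1..<r}"
        using xy w by auto
      \<comment> \<open>At a wall the top letter decides; elsewhere it is constant and
        \<open>k\<close> is not a weak descent, so the bottom letter decides.\<close>
      then show "?f k < ?f (Suc k)"
        using S by (auto simp: cut_Suc weak_descents_def less_prod_def' not_le)
    qed
  qed
  then have "pack (map ?f w) = w"
    by (simp add: pack_map pack_packed[OF w])
  moreover have "zip u (map g w) = map ?f w"
    by (simp add: u zip_map_map zip_same_conv_map)
  moreover have "packed u"
    using set_map_cut[OF w r S(2)] unfolding u packed_def by blast
  ultimately show ?L
    by (simp add: u)
next
  assume L: ?L
  obtain f where f: "zip u (map g w) = map f w" "strict_mono_on (set w) f"
    using pack_factor[of "zip u (map g w)"] L by metis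
  define h where "h = fst \<circ> f"
  have "map fst (zip u (map g w)) = map h w" "map snd (zip u (map g w)) = map (snd \<circ> f) w"
    unfolding f(1) h_def by simp_all
  then have u: "u = map h w" and "map g w = map (snd \<circ> f) w"
    using L by simp_all
  then have g: "g k = snd (f k)" if "k \<in> {1..r}" for k
    using that w by auto
  have flt: "f x < f y" if "x \<in> {1..r}" "y \<in> {1..r}" "x < y" for x y
    using strict_mono_onD[OF f(2), of x y] that w by auto
  \<comment> \<open>Priority of the top letter makes \<open>h\<close> weakly increasing, and
    packedness of \<open>u\<close> makes its image an initial interval, so \<open>h\<close> is a
    cut.\<close>
  have mono: "mono_on {1..r} h"
  proof (rule mono_onI)
    fix x y assume "x \<in> {1..r}" "y \<in> {1..r}" "x \<le> y"
    then show "h x \<le> h y"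
      using flt[of x y] by (cases "x = y") (auto simp: h_def less_prod_def')
  qed
  obtain m where m: "set u = {1..m}"
    using L by (auto simp: packed_def)
  then have img: "h ` {1..r} = {1..m}"
    using u w by simp
  let ?S = "{k \<in> {1..<r}. h k < h (Suc k)}"
  have "map h w = map (cut ?S) w"
    using mono_surj_eq_cut[OF img mono] w by simp
  \<comment> \<open>At a weak descent the bottom letter does not increase, so the top letter has
    to.\<close>
  moreover have "weak_descents g r \<subseteq> ?S"
  proof
    fix k assume k: "k \<in> weak_descents g r"
    then have "k \<in> {1..r}" "Suc k \<in> {1..r}"
      by (auto simp: weak_descents_def)
    then show "k \<in> ?S"
      using k flt[of k "Suc k"] by (auto simp: weak_descents_def h_def less_prod_def' g)
  qed
  ultimately show ?R
    using u by (intro exI[of _ ?S]) auto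
qed

section \<open>Merging as removal of walls, and the value of \<open>a0\<close>\<close>

section \<open>Merging\<close>

text \<open>Two consecutive blocks of a coarsening are separated by a single wall \<open>s\<close>.
  All weak descents are walls, so \<open>g\<close> increases strictly within both blocks, and only
  the step from \<open>s\<close> to \<open>Suc s\<close> matters.\<close>

lemma merge_step_cut_iff:
  assumes w: "set w = {1..r}" and r: "1 \<le> r"
    and S: "weak_descents g r \<subseteq> S" "S \<subseteq> {1..<r}"
  shows "merge_step (map g w) (map (cut S) w) q
    \<longleftrightarrow> (\<exists>s \<in> S - weak_descents g r. q = map (cut (S - {s})) w)" (is "?L \<longleftrightarrow> ?R")
proof -
  let ?p = "map (cut S) w"
  have max: "maxw ?p = Suc (card S)"
    using set_map_cut[OF w r S(2)] by (rule maxw_packed)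
  have mrg: "merge (cut S s) ?p = map (cut (S - {s})) w" if "s \<in> S" for s
    using cut_less_iff[OF that] by (auto simp: merge_def cut_remove[OF that] not_le[symmetric])
  \<comment> \<open>The blockwise condition on positions becomes one on letters, since every letter
    in \<open>{1..r}\<close> occurs in \<open>w\<close>.\<close>
  have blk: "(\<forall>i \<in> block ?p k. \<forall>j \<in> block ?p l. map g w ! i < map g w ! j)
    \<longleftrightarrow> (\<forall>x \<in> {1..r}. \<forall>y \<in> {1..r}. cut S x = k \<longrightarrow> cut S y = l \<longrightarrow> g x < g y)" for k l
    unfolding w[symmetric] by (auto simp: block_def all_set_conv_all_nth)
  show ?thesis
  proof
    assume ?L
    then obtain k where k: "1 \<le> k" "k < Suc (card S)" "q = merge k ?p"
      and less: "\<And>x y. x \<in> {1..r} \<Longrightarrow> y \<in> {1..r} \<Longrightarrow> cut S x = k \<Longrightarrow> cut S y = Suc k \<Longrightarrow> g x < g y"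
      unfolding merge_step_def max blk by blast
    obtain s where s: "s \<in> S" "cut S s = k"
      using cut_wall[OF S(2) k(1,2)] .
    have "g s < g (Suc s)"
      using s S(2) by (intro less) (auto simp: cut_Suc)
    then show ?R
      using s k(3) mrg[OF s(1)] by (intro bexI[of _ s]) (auto simp: weak_descents_def)
  next
    assume ?R
    then obtain s where s: "s \<in> S" "s \<notin> weak_descents g r" and q: "q = map (cut (S - {s})) w"
      by blast
    have "g x < g y"
      if xy: "x \<in> {1..r}" "y \<in> {1..r}" "cut S x = cut S s" "cut S y = Suc (cut S s)" for x y
    proof (rule interval_strict_mono[of x y g])
      show "x < y"
        using xy cut_mono[of y x S] by (intro not_le_imp_less) auto
      fix k assume k: "x \<le> k" "k < y"
      \<comment> \<open>A weak descent between \<open>x\<close> and \<open>y\<close> would be a wall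
        on the level of \<open>s\<close>, hence \<open>s\<close> itself, which is not a weak
        descent.\<close>
      have "k \<notin> weak_descents g r"
      proof
        assume D: "k \<in> weak_descents g r"
        then have "k \<in> S" "k \<noteq> s"
          using S s by auto
        moreover have "cut S s \<le> cut S k" "cut S (Suc k) \<le> Suc (cut S s)"
          using k cut_mono[of x k S] cut_mono[of "Suc k" y S] xy by auto
        ultimately have "cut S k = cut S s"
          by (simp add: cut_Suc)
        then show False
          using cut_less_iff[OF \<open>k \<in> S\<close>, of s] cut_less_iff[OF \<open>s \<in> S\<close>, of k] \<open>k \<noteq> s\<close> by auto
      qed
      then show "g k < g (Suc k)"
        using k xy by (auto simp: weak_descents_def)
    qed
    moreover have "1 \<le> cut S s"
      by (simp add: cut_def)
    moreover have "cut S s < Suc (card S)"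
      using cut_less_iff[OF s(1), of r] s(1) S(2) by (auto simp: cut_top[OF S(2)])
    ultimately show ?L
      unfolding merge_step_def max blk q using mrg[OF s(1)] by (intro exI[of _ "cut S s"]) auto
  qed
qed

text \<open>Starting from all walls, each merge deletes one wall that is not a weak descent, and
  merging stops exactly when only the weak descents remain. This gives both the existence and the
  uniqueness required by \<open>THE\<close>.\<close>

lemma u0_eq:
  assumes w: "set w = {1..r}" and r: "1 \<le> r"
  shows "u0 (map g w) w = map (cut (weak_descents g r)) w"
proof -
  let ?D = "weak_descents g r"
  let ?m = "merge_step (map g w)"
  have D: "?D \<subseteq> {1..<r}"
    by (auto simp: weak_descents_def)
  have start: "map (cut {1..<r}) w = w"
    by (rule map_idI) (use w cut_full in auto)
  have reach: "\<exists>S. ?D \<subseteq> S \<and> S \<subseteq> {1..<r} \<and> q = map (cut S) w" if "?m\<^sup>*\<^sup>* w q" for q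
    using that
  proof (induction rule: rtranclp_induct)
    case base
    then show ?case
      using D start[symmetric] by (intro exI[of _ "{1..<r}"] conjI subset_refl)
  next
    case (step p q)
    then obtain S where S: "?D \<subseteq> S" "S \<subseteq> {1..<r}" "p = map (cut S) w"
      by blast
    then obtain s where "s \<in> S - ?D" "q = map (cut (S - {s})) w"
      using step(2) merge_step_cut_iff[OF w r S(1,2)] by auto
    then show ?case
      using S by (intro exI[of _ "S - {s}"]) auto
  qed
  have descend: "?m\<^sup>*\<^sup>* (map (cut (?D \<union> T)) w) (map (cut ?D) w)"
    if "finite T" "T \<subseteq> {1..<r} - ?D" for T
    using that
  proof (induction T)
    case (insert s T)
    have *: "?D \<subseteq> ?D \<union> insert s T" "?D \<union> insert s T \<subseteq> {1..<r}"
      using insert D by auto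
    have "(?D \<union> insert s T) - {s} = ?D \<union> T"
      using insert by auto
    then have "?m (map (cut (?D \<union> insert s T)) w) (map (cut (?D \<union> T)) w)"
      unfolding merge_step_cut_iff[OF w r *] using insert by (intro bexI[of _ s]) auto
    then show ?case
      using insert by (auto intro: converse_rtranclp_into_rtranclp)
  qed simp
  have "?D \<union> ({1..<r} - ?D) = {1..<r}"
    using D by auto
  then have path: "?m\<^sup>*\<^sup>* w (map (cut ?D) w)"
    using descend[of "{1..<r} - ?D"] start by auto
  show ?thesis
    unfolding u0_def
  proof (rule the_equality)
    show "?m\<^sup>*\<^sup>* w (map (cut ?D) w) \<and> (\<nexists>u'. ?m (map (cut ?D) w) u')"
      using path by (simp add: merge_step_cut_iff[OF w r subset_refl D])
  next
    fix u assume u: "?m\<^sup>*\<^sup>* w u \<and> (\<nexists>u'. ?m u u')"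
    then obtain S where S: "?D \<subseteq> S" "S \<subseteq> {1..<r}" "u = map (cut S) w"
      using reach by blast
    then have "S - ?D = {}"
      using u merge_step_cut_iff[OF w r S(1,2)] by blast
    then show "u = map (cut ?D) w"
      using S by auto
  qed
qed

lemma a0_eq:
  assumes w: "set w = {1..r}" and r: "1 \<le> r"
  shows "a0 (map g w) w = Suc (card (weak_descents g r))"
proof -
  have "weak_descents g r \<subseteq> {1..<r}"
    by (auto simp: weak_descents_def)
  then show ?thesis
    unfolding a0_def u0_eq[OF w r] by (rule maxw_packed[OF set_map_cut[OF w r]])
qed

section \<open>Pascal summation over sets of walls, then comparison of coefficients\<close>

section \<open>Coefficients of the internal product\<close>

lemma binom_Pascal:
  "binom (p + 1) (Suc m) = binom p m + binom p (Suc m)"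
  \<comment> \<open>Evaluation at every scalar reduces the identity to Pascal's rule for
    \<open>gbinomial\<close>; in characteristic 0 the values determine a polynomial.\<close>
  by (rule poly_ext) (simp add: poly_binom gbinomial_Suc_Suc)

text \<open>Subsets without and with a new element \<open>b\<close> give the induction hypothesis at
  \<open>m\<close> and at \<open>Suc m\<close>, hence the general \<open>m\<close>; Pascal's rule
  adds the two results.\<close>

lemma sum_Pow_binom:
  assumes "finite B"
  shows "(\<Sum>T \<in> Pow B. binom p (m + card T)) = binom (p + of_nat (card B)) (m + card B)"
  using assms
proof (induction B arbitrary: m)
  case (insert b B)
  have disj: "Pow B \<inter> insert b ` Pow B = {}"
    using insert.hyps by blast
  have inj: "inj_on (insert b) (Pow B)"
    by (rule inj_onI) (metis PowD in_mono insert.hyps(2) insert_ident)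
  have "(\<Sum>T \<in> Pow (insert b B). binom p (m + card T))
      = (\<Sum>T \<in> Pow B. binom p (m + card T)) + (\<Sum>T \<in> Pow B. binom p (m + card (insert b T)))"
    using insert.hyps(1) by (simp add: Pow_insert sum.union_disjoint[OF _ _ disj] sum.reindex[OF inj])
  also have "(\<Sum>T \<in> Pow B. binom p (m + card (insert b T))) = (\<Sum>T \<in> Pow B. binom p (Suc m + card T))"
  proof (rule sum.cong)
    fix T assume "T \<in> Pow B"
    then have "finite T" "b \<notin> T"
      using insert.hyps by (auto intro: finite_subset)
    then show "binom p (m + card (insert b T)) = binom p (Suc m + card T)"
      by simp
  qed simp
  finally show ?case
    using insert.hyps insert.IH[of m] insert.IH[of "Suc m"]
      binom_Pascal[of "p + of_nat (card B)" "m + card B"]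
    by (simp add: add_ac)
qed simp

lemma sum_interval_binom:
  assumes D: "D \<subseteq> A" and A: "finite A"
  shows "(\<Sum>S | D \<subseteq> S \<and> S \<subseteq> A. binom p (Suc (card S)))
    = binom (p + of_nat (card (A - D))) (Suc (card A))"
proof -
  have fin: "finite D"
    using assms finite_subset by blast
  have "(\<Sum>S | D \<subseteq> S \<and> S \<subseteq> A. binom p (Suc (card S)))
      = (\<Sum>T \<in> Pow (A - D). binom p (Suc (card D) + card T))"
  proof (rule sum.reindex_bij_witness[of _ "\<lambda>T. D \<union> T" "\<lambda>S. S - D"], goal_cases)
    case (5 S)
    have "finite S"
      using 5 A finite_subset by blast
    then show ?case
      using 5 fin card_mono[of S D] by (simp add: card_Diff_subset)
  qed (use D in auto)
  also have "\<dots> = binom (p + of_nat (card (A - D))) (Suc (card D) + card (A - D))"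
    by (rule sum_Pow_binom) (use A in auto)
  also have "Suc (card D) + card (A - D) = Suc (card A)"
    using fin D card_mono[OF A D] by (simp add: card_Diff_subset)
  finally show ?thesis .
qed

lemma lookup_N: "Poly_Mapping.lookup (N u) w = (if w = u then 1 else 0)"
  by (simp add: N_def lookup_single when_def)

text \<open>Any finite \<open>A\<close> containing the support may index the sum, so
  \<open>sigma n\<close> and every \<open>E n k\<close> can share
  \<open>packed_words n\<close>.\<close>

lemma lookup_iprod_N:
  fixes x :: "nat list \<Rightarrow>\<^sub>0 'b::comm_ring_1"
  assumes "finite A" "\<And>u. u \<notin> A \<Longrightarrow> Poly_Mapping.lookup x u = 0"
  shows "Poly_Mapping.lookup (x \<^bold>* N v) w
    = (\<Sum>u | u \<in> A \<and> length u = length v \<and> pack (zip u v) = w. Poly_Mapping.lookup x u)"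
proof -
  have keys_N: "Poly_Mapping.keys (N v :: nat list \<Rightarrow>\<^sub>0 'b) = {v}"
    by (simp add: N_def)
  have "Poly_Mapping.lookup (x \<^bold>* N v) w
      = (\<Sum>u \<in> Poly_Mapping.keys x.
          if length u = length v \<and> pack (zip u v) = w then Poly_Mapping.lookup x u else 0)"
    unfolding iprod_def keys_N Poly_Mapping.lookup_sum
    by (rule sum.cong) (auto simp: lookup_N)
  also have "\<dots> = (\<Sum>u \<in> A.
          if length u = length v \<and> pack (zip u v) = w then Poly_Mapping.lookup x u else 0)"
    using assms by (intro sum.mono_neutral_left) (auto simp: in_keys_iff)
  finally show ?thesis
    using assms(1) by (simp add: sum.inter_filter)
qed

lemma lookup_sigma_iprod_N:
  assumes "n \<ge> 1" "length v = n"
  shows "Poly_Mapping.lookup ((sigma n :: nat list \<Rightarrow>\<^sub>0 'a::field_char_0 poly) \<^bold>* N v) w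
    = (if w \<in> WRef v then binom (tvar + of_nat (maxw w) - of_nat (a0 v w)) (maxw w) else 0)"
proof -
  let ?U = "{u \<in> packed_words n. length u = length v \<and> pack (zip u v) = w}"
  have eq: "Poly_Mapping.lookup ((sigma n :: nat list \<Rightarrow>\<^sub>0 'a poly) \<^bold>* N v) w
      = (\<Sum>u \<in> ?U. binom tvar (maxw u))"
    by (subst lookup_iprod_N[of "packed_words n"]) (auto simp: lookup_sigma intro!: sum.cong)
  show ?thesis
  proof (cases "w \<in> WRef v")
    case False
    then have "?U = {}"
      using pack_zip_in_WRef by auto
    then show ?thesis
      using False by (simp only: eq) simp
  next
    case True
    then have l: "length w = length v" and "packed w"
      by (auto simp: WRef_def packed_words_def)
    then obtain r where w: "set w = {1..r}"
      by (auto simp: packed_def)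
    \<comment> \<open>A word of positive length has a letter; \<open>r = 0\<close> would make
      \<open>w\<close> empty.\<close>
    have r: "1 \<le> r"
      using w l assms by (cases r) auto
    obtain g where g: "v = map g w"
      using WRef_factor[OF True] .
    let ?D = "weak_descents g r"
    have D: "?D \<subseteq> {1..<r}"
      by (auto simp: weak_descents_def)
    have "?U = (\<lambda>S. map (cut S) w) ` {S. ?D \<subseteq> S \<and> S \<subseteq> {1..<r}}"
    proof (rule set_eqI)
      fix u
      have "u \<in> ?U \<longleftrightarrow> packed u \<and> length u = length w \<and> pack (zip u (map g w)) = w"
        using assms(2) by (auto simp: packed_words_def g)
      also have "\<dots> \<longleftrightarrow> u \<in> (\<lambda>S. map (cut S) w) ` {S. ?D \<subseteq> S \<and> S \<subseteq> {1..<r}}"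
        unfolding pack_zip_eq_iff[OF w r] by blast
      finally show "u \<in> ?U \<longleftrightarrow> u \<in> (\<lambda>S. map (cut S) w) ` {S. ?D \<subseteq> S \<and> S \<subseteq> {1..<r}}" .
    qed
    moreover have "inj_on (\<lambda>S. map (cut S) w) {S. ?D \<subseteq> S \<and> S \<subseteq> {1..<r}}"
      by (rule inj_on_subset[OF inj_on_map_cut[OF w]]) auto
    ultimately have "(\<Sum>u \<in> ?U. binom (tvar :: 'a poly) (maxw u))
        = (\<Sum>S | ?D \<subseteq> S \<and> S \<subseteq> {1..<r}. binom tvar (maxw (map (cut S) w)))"
      by (simp only: sum.reindex comp_def)
    also have "\<dots> = (\<Sum>S | ?D \<subseteq> S \<and> S \<subseteq> {1..<r}. binom tvar (Suc (card S)))"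
      by (intro sum.cong refl) (simp only: mem_Collect_eq maxw_packed[OF set_map_cut[OF w r]])
    also have "\<dots> = binom (tvar + of_nat (card ({1..<r} - ?D))) (Suc (card {1..<r}))"
      by (rule sum_interval_binom[OF D]) simp
    also have "Suc (card {1..<r}) = maxw w"
      using r maxw_packed[OF w] by simp
    \<comment> \<open>Of the \<open>r - 1\<close> walls \<open>card ?D\<close> are forced, and
      \<open>a0 v w\<close> is \<open>Suc (card ?D)\<close>, so the two shifts by 1 cancel.\<close>
    also have "card ({1..<r} - ?D) = maxw w - a0 v w"
      using finite_subset[OF D] D
      by (simp add: card_Diff_subset g a0_eq[OF w r] maxw_packed[OF w])
    \<comment> \<open>The truncated difference is a true one because \<open>a0 v w\<close> is at
      most \<open>maxw w\<close>.\<close>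
    also have "of_nat (maxw w - a0 v w) = (of_nat (maxw w) - of_nat (a0 v w) :: 'a poly)"
      using card_mono[OF _ D] r by (intro of_nat_diff) (simp add: g a0_eq[OF w r] maxw_packed[OF w])
    finally show ?thesis
      using True by (simp add: eq add_diff_eq)
  qed
qed

text \<open>For fixed \<open>v\<close> each coefficient of the product is a sum of coefficients of
  the left factor, so the expansion in powers of \<open>t\<close> passes through it after exchanging
  the two sums.\<close>

lemma sigma_iprod_N_eq_sum_E:
  assumes "n \<ge> 1"
  shows "(sigma n :: nat list \<Rightarrow>\<^sub>0 'a::field_char_0 poly) \<^bold>* N v
    = (\<Sum>k=1..n. scale (monom 1 k) (extend (E n k \<^bold>* N v)))"
proof (rule poly_mapping_eqI)
  fix w
  let ?U = "{u \<in> packed_words n. length u = length v \<and> pack (zip u v) = w}"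
  let ?s = "sigma n :: nat list \<Rightarrow>\<^sub>0 'a poly"
  have "Poly_Mapping.lookup (?s \<^bold>* N v) w = (\<Sum>u \<in> ?U. Poly_Mapping.lookup ?s u)"
    by (rule lookup_iprod_N) (auto simp: lookup_sigma)
  also have "\<dots> = (\<Sum>u \<in> ?U. \<Sum>k=1..n. monom (coeff (Poly_Mapping.lookup ?s u) k) k)"
    by (subst sigma_eq_sum_E[OF assms]) (simp add: Poly_Mapping.lookup_sum smult_monom)
  also have "\<dots> = (\<Sum>k=1..n. \<Sum>u \<in> ?U. monom (coeff (Poly_Mapping.lookup ?s u) k) k)"
    by (rule sum.swap)
  also have "\<dots> = (\<Sum>k=1..n. monom (Poly_Mapping.lookup (E n k \<^bold>* N v) w) k)"
    by (subst lookup_iprod_N[of "packed_words n"]) (auto simp: lookup_sigma monom_sum)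
  also have "\<dots> = Poly_Mapping.lookup (\<Sum>k=1..n. scale (monom 1 k) (extend (E n k \<^bold>* N v))) w"
    by (simp add: Poly_Mapping.lookup_sum smult_monom)
  finally show "Poly_Mapping.lookup (?s \<^bold>* N v) w
    = Poly_Mapping.lookup (\<Sum>k=1..n. scale (monom 1 k) (extend (E n k \<^bold>* N v))) w" .
qed

theorem mainTheorem3:
  fixes n :: nat and v :: "nat list"
  assumes "n \<ge> 1" and "v \<in> packed_words n"
  shows "(sigma n :: nat list \<Rightarrow>\<^sub>0 'a::field_char_0 poly) \<^bold>* N v
           = (\<Sum>k=1..n. scale (monom 1 k) (extend (E n k \<^bold>* N v)))
       \<and> (\<Sum>k=1..n. scale (monom 1 k) (extend ((E n k :: nat list \<Rightarrow>\<^sub>0 'a) \<^bold>* N v)))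
           = (\<Sum>w \<in> WRef v. scale (binom (tvar + of_nat (maxw w) - of_nat (a0 v w)) (maxw w)) (N w))"
proof -
  let ?c = "\<lambda>w. binom (tvar + of_nat (maxw w) - of_nat (a0 v w)) (maxw w) :: 'a poly"
  have fin: "finite (WRef v)"
    by (rule finite_subset[of _ "packed_words (length v)"]) (auto simp: WRef_def)
  have len: "length v = n"
    using assms(2) by (simp add: packed_words_def)
  have "(sigma n :: nat list \<Rightarrow>\<^sub>0 'a poly) \<^bold>* N v = (\<Sum>w \<in> WRef v. scale (?c w) (N w))"
  proof (rule poly_mapping_eqI)
    fix u
    have "Poly_Mapping.lookup (\<Sum>w \<in> WRef v. scale (?c w) (N w)) u
        = (\<Sum>w \<in> WRef v. if u = w then ?c w else 0)"
      unfolding Poly_Mapping.lookup_sum by (rule sum.cong) (simp_all add: lookup_N)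
    also have "\<dots> = (if u \<in> WRef v then ?c u else 0)"
      using fin by (rule sum.delta')
    also have "\<dots> = Poly_Mapping.lookup (sigma n \<^bold>* N v) u"
      by (rule lookup_sigma_iprod_N[OF assms(1) len, symmetric])
    finally show "Poly_Mapping.lookup (sigma n \<^bold>* N v) u
        = Poly_Mapping.lookup (\<Sum>w \<in> WRef v. scale (?c w) (N w)) u"
      by (rule sym)
  qed
  then show ?thesis
    \<comment> \<open>The rewriting makes the first equation reflexive and turns the fact just
      proved into the second.\<close>
    unfolding sigma_iprod_N_eq_sum_E[OF assms(1)] by (rule conjI[OF refl])
qed

end
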